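(* Let $\alpha(t)$ be a null curve with tangent vector field $\xi=\alpha'$ in a 4-dimensional Lorentzian manifold $M_1^4$ with metric $g$. Let $f:M_1^4\to\mathbb{R}$ be an eikonal function along the curve $\alpha$. Then $\alpha$ is a null $f$-eikonal helix if and only if $f$ is a linear function along $\alpha$.
   Context: $M_1^4$ is a 4-dimensional Lorentzian manifold with metric $g$, where $g(a,b)=-a_1b_1+a_2b_2+a_3b_3+a_4b_4$ for tangent vectors $a=(a_1,a_2,a_3,a_4)$, $b=(b_1,b_2,b_3,b_4)$. A curve $\alpha(t)$ in $M_1^4$ is null if $g(\alpha'(t),\alpha'(t))=0$ and $\alpha'(t)\neq 0$ for all $t$. The gradient $\nabla f$ of $f$ is defined by $g(\nabla f,X)=df(X)=X(f)$ for all vector fields $X$ on $M_1^4$. The function $f$ is eikonal along $\alpha$ if $\|\nabla f\|=\sqrt{|g(\nabla f,\nabla f)|}$ is constant along $\alpha$. For $f$ eikonal along $\alpha$, the null curve $\alpha$ is called a null $f$-eikonal helix if the function $g(\nabla f,\xi)$ is a non-zero constant along $\alpha$. "$f$ is a linear function along $\alpha$" means that $\frac{d}{dt}(f\circ\alpha)$ is constant along $\alpha$.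
   Formalization: The "if" direction fails when f is constant along α (slope zero, e.g. f = x₃ and α(t) = (t,t,0,0) in Minkowski space), so the equivalence is stated as: α is a null f-eikonal helix iff f is linear along α and f∘α is not constant. *)

theory Defs
  imports "HOL-Analysis.Analysis"
begin

section \<open>Smooth maps between normed spaces\<close>

primrec Ck_on :: "nat \<Rightarrow> 'a::real_normed_vector set \<Rightarrow> ('a \<Rightarrow> 'b::real_normed_vector) \<Rightarrow> bool" where
  "Ck_on 0 S f \<longleftrightarrow> continuous_on S f"
| "Ck_on (Suc k) S f \<longleftrightarrow>
     (\<forall>x\<in>S. f differentiable (at x)) \<and> (\<forall>v. Ck_on k S (\<lambda>x. frechet_derivative f (at x) v))"

text \<open>Meaningful for open \<open>S\<close> only, since the derivatives are two-sided.\<close>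

definition smooth_on :: "'a::real_normed_vector set \<Rightarrow> ('a \<Rightarrow> 'b::real_normed_vector) \<Rightarrow> bool" where
  "smooth_on S f \<longleftrightarrow> (\<forall>k. Ck_on k S f)"

section \<open>Smooth 4-manifolds\<close>

type_synonym 'm chart = "'m set \<times> ('m \<Rightarrow> real^4)"

definition is_chart :: "'m topology \<Rightarrow> 'm chart \<Rightarrow> bool" where
  "is_chart M = (\<lambda>(U, \<phi>). openin M U \<and> open (\<phi> ` U) \<and>
     homeomorphic_map (subtopology M U) (top_of_set (\<phi> ` U)) \<phi>)"

definition smooth_4_manifold :: "'m topology \<Rightarrow> 'm chart set \<Rightarrow> bool" where
  "smooth_4_manifold M A \<longleftrightarrow>
     Hausdorff_space M \<and> second_countable M \<and>
     (\<forall>c\<in>A. is_chart M c) \<and> (\<Union>(U, \<phi>)\<in>A. U) = topspace M \<and>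
     (\<forall>(U, \<phi>)\<in>A. \<forall>(V, \<psi>)\<in>A. smooth_on (\<phi> ` (U \<inter> V)) (\<psi> \<circ> inv_into U \<phi>))"

definition smooth_fun :: "'m chart set \<Rightarrow> ('m \<Rightarrow> real) \<Rightarrow> bool" where
  "smooth_fun A f \<longleftrightarrow> (\<forall>(U, \<phi>)\<in>A. smooth_on (\<phi> ` U) (f \<circ> inv_into U \<phi>))"

text \<open>
  A tangent vector at \<open>p\<close> is a derivation at \<open>p\<close> of the algebra of smooth functions. Functions live
  on the whole type \<open>'m\<close>, but their values off the manifold do not matter: a smooth function that
  vanishes on \<open>topspace M\<close> equals its product with the indicator function of the complement, so
  by the Leibniz rule every derivation kills it. The last clause makes a derivation determined by
  its values on smooth functions.
\<close>

type_synonym 'm tvec = "('m \<Rightarrow> real) \<Rightarrow> real"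

definition tangent_space :: "'m chart set \<Rightarrow> 'm \<Rightarrow> 'm tvec set" where
  "tangent_space A p = {v.
     (\<forall>f h. smooth_fun A f \<and> smooth_fun A h \<longrightarrow> v (\<lambda>q. f q + h q) = v f + v h) \<and>
     (\<forall>c f. smooth_fun A f \<longrightarrow> v (\<lambda>q. c * f q) = c * v f) \<and>
     (\<forall>f h. smooth_fun A f \<and> smooth_fun A h \<longrightarrow> v (\<lambda>q. f q * h q) = f p * v h + h p * v f) \<and>
     (\<forall>f. \<not> smooth_fun A f \<longrightarrow> v f = 0)}"

definition zero_tvec :: "'m tvec" where
  "zero_tvec = (\<lambda>f. 0)"

definition lin_comb :: "(4 \<Rightarrow> 'm tvec) \<Rightarrow> real^4 \<Rightarrow> 'm tvec" where
  "lin_comb E a = (\<lambda>f. \<Sum>i\<in>UNIV. a $ i * E i f)"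

definition tangent_basis :: "'m chart set \<Rightarrow> 'm \<Rightarrow> (4 \<Rightarrow> 'm tvec) \<Rightarrow> bool" where
  "tangent_basis A p E \<longleftrightarrow>
     (\<forall>i. E i \<in> tangent_space A p) \<and> (\<forall>v\<in>tangent_space A p. \<exists>!a. v = lin_comb E a)"

definition smooth_vector_field :: "'m topology \<Rightarrow> 'm chart set \<Rightarrow> ('m \<Rightarrow> 'm tvec) \<Rightarrow> bool" where
  "smooth_vector_field M A X \<longleftrightarrow>
     (\<forall>p\<in>topspace M. X p \<in> tangent_space A p) \<and>
     (\<forall>f. smooth_fun A f \<longrightarrow> smooth_fun A (\<lambda>p. X p f))"

section \<open>Lorentzian metrics and gradients\<close>

type_synonym 'm metric = "'m \<Rightarrow> 'm tvec \<Rightarrow> 'm tvec \<Rightarrow> real"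

text \<open>
  The first conjunct gives every tangent space a pseudo-orthonormal basis; bilinearity, symmetry,
  nondegeneracy and the signature \<open>(-,+,+,+)\<close> all follow from it.
\<close>

definition lorentzian_metric :: "'m topology \<Rightarrow> 'm chart set \<Rightarrow> 'm metric \<Rightarrow> bool" where
  "lorentzian_metric M A g \<longleftrightarrow>
     (\<forall>p\<in>topspace M. \<exists>E. tangent_basis A p E \<and>
        (\<forall>a b. g p (lin_comb E a) (lin_comb E b) =
           - (a $ 1 * b $ 1) + a $ 2 * b $ 2 + a $ 3 * b $ 3 + a $ 4 * b $ 4)) \<and>
     (\<forall>X Y. smooth_vector_field M A X \<and> smooth_vector_field M A Y \<longrightarrow>
        smooth_fun A (\<lambda>p. g p (X p) (Y p)))"

definition lorentzian_4_manifold :: "'m topology \<Rightarrow> 'm chart set \<Rightarrow> 'm metric \<Rightarrow> bool" where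
  "lorentzian_4_manifold M A g \<longleftrightarrow> smooth_4_manifold M A \<and> lorentzian_metric M A g"

text \<open>
  The defining identity \<open>g(grad f, X) = X(f)\<close> is tensorial in \<open>X\<close>, so it is imposed at each point
  on all tangent vectors, i.e. on all values of vector fields there.
\<close>

definition gradient :: "'m chart set \<Rightarrow> 'm metric \<Rightarrow> ('m \<Rightarrow> real) \<Rightarrow> 'm \<Rightarrow> 'm tvec" where
  "gradient A g f p =
     (THE w. w \<in> tangent_space A p \<and> (\<forall>v\<in>tangent_space A p. g p w v = v f))"

section \<open>Curves\<close>

definition smooth_curve :: "'m topology \<Rightarrow> 'm chart set \<Rightarrow> real set \<Rightarrow> (real \<Rightarrow> 'm) \<Rightarrow> bool" where
  "smooth_curve M A I \<alpha> \<longleftrightarrow>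
     open I \<and> is_interval I \<and> I \<noteq> {} \<and> continuous_map (top_of_set I) M \<alpha> \<and>
     (\<forall>(U, \<phi>)\<in>A. smooth_on {t \<in> I. \<alpha> t \<in> U} (\<phi> \<circ> \<alpha>))"

definition velocity :: "'m chart set \<Rightarrow> (real \<Rightarrow> 'm) \<Rightarrow> real \<Rightarrow> 'm tvec" where
  "velocity A \<alpha> t = (\<lambda>f. if smooth_fun A f then deriv (f \<circ> \<alpha>) t else 0)"

definition null_curve ::
    "'m topology \<Rightarrow> 'm chart set \<Rightarrow> 'm metric \<Rightarrow> real set \<Rightarrow> (real \<Rightarrow> 'm) \<Rightarrow> bool" where
  "null_curve M A g I \<alpha> \<longleftrightarrow>
     smooth_curve M A I \<alpha> \<and>
     (\<forall>t\<in>I. g (\<alpha> t) (velocity A \<alpha> t) (velocity A \<alpha> t) = 0 \<and> velocity A \<alpha> t \<noteq> zero_tvec)"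

definition eikonal_along ::
    "'m chart set \<Rightarrow> 'm metric \<Rightarrow> real set \<Rightarrow> (real \<Rightarrow> 'm) \<Rightarrow> ('m \<Rightarrow> real) \<Rightarrow> bool" where
  "eikonal_along A g I \<alpha> f \<longleftrightarrow>
     (\<lambda>t. sqrt \<bar>g (\<alpha> t) (gradient A g f (\<alpha> t)) (gradient A g f (\<alpha> t))\<bar>) constant_on I"

definition null_eikonal_helix ::
    "'m topology \<Rightarrow> 'm chart set \<Rightarrow> 'm metric \<Rightarrow> real set \<Rightarrow> (real \<Rightarrow> 'm) \<Rightarrow> ('m \<Rightarrow> real) \<Rightarrow> bool" where
  "null_eikonal_helix M A g I \<alpha> f \<longleftrightarrow>
     null_curve M A g I \<alpha> \<and> eikonal_along A g I \<alpha> f \<and>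
     (\<exists>c. c \<noteq> 0 \<and> (\<forall>t\<in>I. g (\<alpha> t) (gradient A g f (\<alpha> t)) (velocity A \<alpha> t) = c))"

text \<open>
  The slope may be zero. A helix needs a nonzero slope, so along a linear \<open>f\<close> the helix condition
  can hold only if \<open>f \<circ> \<alpha>\<close> is not constant.
\<close>

definition linear_along :: "real set \<Rightarrow> (real \<Rightarrow> 'm) \<Rightarrow> ('m \<Rightarrow> real) \<Rightarrow> bool" where
  "linear_along I \<alpha> f \<longleftrightarrow> (\<exists>c. \<forall>t\<in>I. ((f \<circ> \<alpha>) has_real_derivative c) (at t))"

end

theory Submission
  imports Defs
begin

text \<open>
  The defining property of the gradient, applied to the velocity \<open>\<xi>\<close> of the curve, reads
  \<open>g(grad f, \<xi>) = \<xi>(f) = (f \<circ> \<alpha>)'\<close>. Hence \<open>g(grad f, \<xi>)\<close> is constant along \<open>\<alpha>\<close> if and only if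
  \<open>f \<circ> \<alpha>\<close> has constant derivative, and on an open interval that constant is nonzero if and only
  if \<open>f \<circ> \<alpha>\<close> is not constant.

  Two points have to be justified. First, the gradient exists: in a pseudo-orthonormal basis its
  coordinates are the derivatives of \<open>f\<close> along the basis vectors, with the sign of the timelike
  one reversed (\<open>gradient_characterization\<close>). Second, the velocity really is a tangent vector
  (\<open>velocity_in_tangent_space\<close>): the composition of a smooth function with \<open>\<alpha>\<close> is differentiable,
  which is seen in a chart, and sums and products of smooth functions are smooth, so that the
  usual rules of differentiation can be applied to them.
\<close>

section \<open>Algebra of smooth functions\<close>

text \<open>
  The derivatives in the definition of \<open>Ck_on\<close> are taken at points of \<open>S\<close> but look at a
  neighbourhood, so that only on an open set is the notion local.
\<close>

lemma Ck_on_cong: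
  assumes "open S" and "\<And>x. x \<in> S \<Longrightarrow> f x = h x" and "Ck_on k S f"
  shows "Ck_on k S h"
  using assms(2,3)
proof (induction k arbitrary: f h)
  case 0
  then show ?case by (simp cong: continuous_on_cong)
next
  case (Suc k)
  have derivative_transfer: "(h has_derivative D) (at x)"
    if "x \<in> S" "(f has_derivative D) (at x)" for x D
    using has_derivative_transform_within_open[OF that(2) \<open>open S\<close> that(1)] Suc.prems(1) by blast
  have h_deriv: "(h has_derivative frechet_derivative f (at x)) (at x)" if "x \<in> S" for x
    using derivative_transfer[OF that] Suc.prems(2) that frechet_derivative_works by auto
  have "Ck_on k S (\<lambda>x. frechet_derivative h (at x) v)" for v
  proof (rule Suc.IH)
    show "frechet_derivative f (at x) v = frechet_derivative h (at x) v" if "x \<in> S" for x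
      using frechet_derivative_at[OF h_deriv[OF that]] by simp
    show "Ck_on k S (\<lambda>x. frechet_derivative f (at x) v)"
      using Suc.prems(2) by simp
  qed
  moreover have "\<forall>x\<in>S. h differentiable (at x)"
    using h_deriv differentiableI by blast
  ultimately show ?case by simp
qed

lemma Ck_on_SucD: "Ck_on (Suc k) S f \<Longrightarrow> Ck_on k S f"
proof (induction k arbitrary: f)
  case 0
  then show ?case
    by (auto intro: continuous_at_imp_continuous_on differentiable_imp_continuous_within)
next
  case (Suc k)
  show ?case
    unfolding Ck_on.simps(2)[of k]
  proof (intro conjI allI)
    show "\<forall>x\<in>S. f differentiable (at x)"
      using Suc.prems by simp
    show "Ck_on k S (\<lambda>x. frechet_derivative f (at x) v)" for v
      using Suc.prems unfolding Ck_on.simps(2)[of "Suc k"] by (blast intro: Suc.IH)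
  qed
qed

lemma Ck_on_const: "Ck_on k S (\<lambda>x. c)"
  by (induction k arbitrary: c) simp_all

lemma Ck_on_add:
  assumes "open S" and "Ck_on k S f" and "Ck_on k S h"
  shows "Ck_on k S (\<lambda>x. f x + h x)"
  using assms(2,3)
proof (induction k arbitrary: f h)
  case 0
  then show ?case by (simp add: continuous_on_add)
next
  case (Suc k)
  have deriv: "((\<lambda>x. f x + h x) has_derivative
      (\<lambda>v. frechet_derivative f (at x) v + frechet_derivative h (at x) v)) (at x)"
    if "x \<in> S" for x
    using Suc.prems that by (intro has_derivative_add) (simp_all flip: frechet_derivative_works)
  have "Ck_on k S (\<lambda>x. frechet_derivative (\<lambda>x. f x + h x) (at x) v)" for v
  proof (rule Ck_on_cong[OF \<open>open S\<close>])
    show "Ck_on k S (\<lambda>x. frechet_derivative f (at x) v + frechet_derivative h (at x) v)"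
      using Suc by simp
  qed (simp flip: frechet_derivative_at[OF deriv])
  moreover have "\<forall>x\<in>S. (\<lambda>x. f x + h x) differentiable (at x)"
    using deriv differentiableI by blast
  ultimately show ?case by simp
qed

lemma Ck_on_mult:
  fixes f h :: "'a::real_normed_vector \<Rightarrow> 'b::real_normed_algebra"
  assumes "open S" and "Ck_on k S f" and "Ck_on k S h"
  shows "Ck_on k S (\<lambda>x. f x * h x)"
  using assms(2,3)
proof (induction k arbitrary: f h)
  case 0
  then show ?case by (simp add: continuous_on_mult)
next
  case (Suc k)
  have deriv: "((\<lambda>x. f x * h x) has_derivative
      (\<lambda>v. f x * frechet_derivative h (at x) v + frechet_derivative f (at x) v * h x)) (at x)"
    if "x \<in> S" for x
    using Suc.prems that by (intro has_derivative_mult) (simp_all flip: frechet_derivative_works)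
  have "Ck_on k S (\<lambda>x. frechet_derivative (\<lambda>x. f x * h x) (at x) v)" for v
  proof (rule Ck_on_cong[OF \<open>open S\<close>])
    show "Ck_on k S
        (\<lambda>x. f x * frechet_derivative h (at x) v + frechet_derivative f (at x) v * h x)"
      using Suc.prems Ck_on_SucD[OF Suc.prems(1)] Ck_on_SucD[OF Suc.prems(2)]
      by (intro Ck_on_add[OF \<open>open S\<close>] Suc.IH) simp_all
  qed (simp flip: frechet_derivative_at[OF deriv])
  moreover have "\<forall>x\<in>S. (\<lambda>x. f x * h x) differentiable (at x)"
    using deriv differentiableI by blast
  ultimately show ?case by simp
qed

lemma smooth_on_imp_differentiable:
  assumes "smooth_on S f" and "x \<in> S"
  shows "f differentiable (at x)"
  using assms Ck_on.simps(2)[of 0 S f] unfolding smooth_on_def by blast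

lemma open_chart_image:
  assumes "smooth_4_manifold M A" and "(U, \<phi>) \<in> A"
  shows "open (\<phi> ` U)"
  using assms unfolding smooth_4_manifold_def is_chart_def by fastforce

lemma smooth_fun_add:
  assumes "smooth_4_manifold M A" and "smooth_fun A f" and "smooth_fun A h"
  shows "smooth_fun A (\<lambda>q. f q + h q)"
  using assms open_chart_image[OF assms(1)]
  by (fastforce simp: smooth_fun_def smooth_on_def comp_def intro: Ck_on_add)

lemma smooth_fun_mult:
  assumes "smooth_4_manifold M A" and "smooth_fun A f" and "smooth_fun A h"
  shows "smooth_fun A (\<lambda>q. f q * h q)"
  using assms open_chart_image[OF assms(1)]
  by (fastforce simp: smooth_fun_def smooth_on_def comp_def intro: Ck_on_mult)

lemma smooth_fun_const: "smooth_fun A (\<lambda>q. c)"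
  by (auto simp: smooth_fun_def smooth_on_def comp_def Ck_on_const)

section \<open>Velocities are tangent vectors\<close>

lemma smooth_curve_in_topspace:
  assumes "smooth_curve M A I \<alpha>" and "t \<in> I"
  shows "\<alpha> t \<in> topspace M"
  using assms unfolding smooth_curve_def continuous_map_def by auto

text \<open>
  Near \<open>t\<close> the curve stays in the domain of one chart \<open>\<phi>\<close>, and there \<open>f \<circ> \<alpha>\<close> is the composition
  of the coordinate expressions \<open>f \<circ> \<phi>\<^sup>-\<^sup>1\<close> and \<open>\<phi> \<circ> \<alpha>\<close>, to which the chain rule applies.
\<close>

lemma smooth_fun_along_curve_has_derivative:
  assumes "smooth_4_manifold M A" and "smooth_curve M A I \<alpha>" and "smooth_fun A f" and "t \<in> I"
  shows "((f \<circ> \<alpha>) has_real_derivative deriv (f \<circ> \<alpha>) t) (at t)"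
proof -
  have "open I" and cont: "continuous_map (top_of_set I) M \<alpha>"
    using assms(2) unfolding smooth_curve_def by auto
  have "\<alpha> t \<in> topspace M"
    using assms(2,4) by (rule smooth_curve_in_topspace)
  then obtain U \<phi> where chart: "(U, \<phi>) \<in> A" and "\<alpha> t \<in> U"
    using assms(1) unfolding smooth_4_manifold_def by blast
  then have "openin M U" and hom: "homeomorphic_map (subtopology M U) (top_of_set (\<phi> ` U)) \<phi>"
    using assms(1) unfolding smooth_4_manifold_def is_chart_def by fastforce+
  then have "inj_on \<phi> U"
    using homeomorphic_imp_injective_map[OF hom] openin_subset[of M U] by (simp add: Int_absorb1)
  define J where "J = {s \<in> I. \<alpha> s \<in> U}"
  have "open J"
    using openin_continuous_map_preimage[OF cont \<open>openin M U\<close>] openin_open_trans[OF _ \<open>open I\<close>]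
    unfolding J_def by simp
  have "t \<in> J"
    using \<open>t \<in> I\<close> \<open>\<alpha> t \<in> U\<close> unfolding J_def by simp
  have "(\<phi> \<circ> \<alpha>) differentiable (at t)"
    using assms(2) chart \<open>t \<in> J\<close> unfolding smooth_curve_def J_def
    by (fastforce intro: smooth_on_imp_differentiable)
  moreover have "(f \<circ> inv_into U \<phi>) differentiable (at ((\<phi> \<circ> \<alpha>) t))"
    using assms(3) chart \<open>\<alpha> t \<in> U\<close> unfolding smooth_fun_def
    by (fastforce intro: smooth_on_imp_differentiable)
  ultimately have "((f \<circ> inv_into U \<phi>) \<circ> (\<phi> \<circ> \<alpha>)) differentiable (at t)"
    by (rule differentiable_chain_at)
  then obtain D where D: "(((f \<circ> inv_into U \<phi>) \<circ> (\<phi> \<circ> \<alpha>)) has_real_derivative D) (at t)"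
    by (auto simp: real_differentiable_def)
  have "((f \<circ> \<alpha>) has_real_derivative D) (at t)"
    using has_field_derivative_transform_within_open[OF D \<open>open J\<close> \<open>t \<in> J\<close>] \<open>inj_on \<phi> U\<close>
    unfolding J_def by simp
  then show ?thesis
    using DERIV_imp_deriv by blast
qed

lemma velocity_in_tangent_space:
  assumes "smooth_4_manifold M A" and "smooth_curve M A I \<alpha>" and "t \<in> I"
  shows "velocity A \<alpha> t \<in> tangent_space A (\<alpha> t)"
proof -
  note D = smooth_fun_along_curve_has_derivative[OF assms(1,2) _ assms(3), unfolded comp_def]
  have "deriv (\<lambda>s. f (\<alpha> s) + h (\<alpha> s)) t = deriv (\<lambda>s. f (\<alpha> s)) t + deriv (\<lambda>s. h (\<alpha> s)) t"
    if "smooth_fun A f" "smooth_fun A h" for f h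
    using that by (intro DERIV_imp_deriv DERIV_add D)
  moreover have "deriv (\<lambda>s. c * f (\<alpha> s)) t = c * deriv (\<lambda>s. f (\<alpha> s)) t"
    if "smooth_fun A f" for c f
    using that by (intro DERIV_imp_deriv DERIV_cmult D)
  moreover have "deriv (\<lambda>s. f (\<alpha> s) * h (\<alpha> s)) t =
      f (\<alpha> t) * deriv (\<lambda>s. h (\<alpha> s)) t + h (\<alpha> t) * deriv (\<lambda>s. f (\<alpha> s)) t"
    if "smooth_fun A f" "smooth_fun A h" for f h
    using DERIV_imp_deriv[OF DERIV_mult[OF D[OF that(1)] D[OF that(2)]]]
    by (simp add: algebra_simps)
  ultimately show ?thesis
    using smooth_fun_add[OF assms(1)] smooth_fun_mult[OF assms(1)]
      smooth_fun_mult[OF assms(1) smooth_fun_const]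
    unfolding tangent_space_def velocity_def comp_def by simp
qed

section \<open>The gradient\<close>

lemma lin_comb_in_tangent_space:
  assumes "\<And>i. E i \<in> tangent_space A p"
  shows "lin_comb E a \<in> tangent_space A p"
  using assms unfolding tangent_space_def lin_comb_def
  by (simp add: sum.distrib sum_distrib_left algebra_simps)

lemma lin_comb_axis: "lin_comb E (axis i 1) = E i"
proof -
  have "axis i (1::real) $ j * E j f = (if i = j then E j f else 0)" for j f
    by (simp add: axis_def)
  then show ?thesis
    unfolding lin_comb_def by simp
qed

text \<open>
  The signs in the witness \<open>a\<close> are forced: pairing \<open>lin_comb E a\<close> with the basis vector \<open>E i\<close>
  gives \<open>- a $ 1\<close> for \<open>i = 1\<close> and \<open>a $ i\<close> otherwise, and this has to equal \<open>E i f\<close>. The same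
  computation gives uniqueness, without which the description in the definition of the gradient
  would not denote this vector.
\<close>

lemma gradient_characterization:
  assumes "lorentzian_metric M A g" and "p \<in> topspace M" and "v \<in> tangent_space A p"
  shows "g p (gradient A g f p) v = v f"
proof -
  obtain E where basis: "tangent_basis A p E"
    and g_coords: "\<And>a b. g p (lin_comb E a) (lin_comb E b) =
           - (a $ 1 * b $ 1) + a $ 2 * b $ 2 + a $ 3 * b $ 3 + a $ 4 * b $ 4"
    using assms(1,2) unfolding lorentzian_metric_def by blast
  have E: "\<And>i. E i \<in> tangent_space A p"
    and coords: "\<And>w. w \<in> tangent_space A p \<Longrightarrow> \<exists>b. w = lin_comb E b"
    using basis unfolding tangent_basis_def by blast+
  define a :: "real^4" where "a = (\<chi> i. if i = 1 then - E 1 f else E i f)"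
  have "\<exists>!w. w \<in> tangent_space A p \<and> (\<forall>v\<in>tangent_space A p. g p w v = v f)"
  proof (rule ex1I)
    have "g p (lin_comb E a) w = w f" if w: "w \<in> tangent_space A p" for w
    proof -
      obtain b where "w = lin_comb E b"
        using coords[OF w] by blast
      then show ?thesis
        unfolding \<open>w = lin_comb E b\<close> g_coords by (simp add: a_def lin_comb_def sum_4 mult.commute)
    qed
    then show "lin_comb E a \<in> tangent_space A p \<and>
        (\<forall>v\<in>tangent_space A p. g p (lin_comb E a) v = v f)"
      using lin_comb_in_tangent_space[of E, OF E] by simp
  next
    fix w
    assume w: "w \<in> tangent_space A p \<and> (\<forall>v\<in>tangent_space A p. g p w v = v f)"
    then obtain b where b: "w = lin_comb E b"
      using coords by blast
    have pairing: "g p (lin_comb E b) (lin_comb E (axis i 1)) = E i f" for i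
      using w E b by (simp add: lin_comb_axis)
    have "b = a"
      using pairing[of 1] pairing[of 2] pairing[of 3] pairing[of 4]
      unfolding vec_eq_iff forall_4 g_coords by (simp add: axis_def a_def)
    then show "w = lin_comb E a"
      using b by simp
  qed
  from theI'[OF this] show ?thesis
    using assms(3) unfolding gradient_def by blast
qed

lemma gradient_velocity_eq_deriv:
  assumes "lorentzian_4_manifold M A g" and "smooth_curve M A I \<alpha>" and "smooth_fun A f" and "t \<in> I"
  shows "g (\<alpha> t) (gradient A g f (\<alpha> t)) (velocity A \<alpha> t) = deriv (f \<circ> \<alpha>) t"
proof -
  have M: "smooth_4_manifold M A" "lorentzian_metric M A g"
    using assms(1) unfolding lorentzian_4_manifold_def by auto
  have "\<alpha> t \<in> topspace M"
    using assms(2,4) by (rule smooth_curve_in_topspace)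
  from gradient_characterization[OF M(2) this velocity_in_tangent_space[OF M(1) assms(2,4)]]
  show ?thesis
    using assms(3) by (simp add: velocity_def)
qed

section \<open>Null eikonal helices\<close>

lemma constant_on_interval_iff_slope_zero:
  fixes h :: "real \<Rightarrow> real"
  assumes "open I" and "is_interval I" and "I \<noteq> {}"
    and "\<And>t. t \<in> I \<Longrightarrow> (h has_real_derivative c) (at t)"
  shows "h constant_on I \<longleftrightarrow> c = 0"
proof
  assume "h constant_on I"
  then obtain d where d: "\<And>t. t \<in> I \<Longrightarrow> h t = d"
    unfolding constant_on_def by blast
  obtain t where "t \<in> I"
    using assms(3) by blast
  have "((\<lambda>_. d) has_real_derivative c) (at t)"
    using has_field_derivative_transform_within_open[OF assms(4)[OF \<open>t \<in> I\<close>] assms(1) \<open>t \<in> I\<close>] d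
    by simp
  then show "c = 0"
    using DERIV_unique DERIV_const by blast
next
  assume "c = 0"
  then have "\<exists>d. \<forall>t\<in>I. h t = d"
    using assms(2,4) has_field_derivative_zero_constant[of I h] has_field_derivative_at_within
    by (fastforce simp: is_interval_convex)
  then show "h constant_on I"
    unfolding constant_on_def by blast
qed

theorem theorem1:
  fixes M :: "'m topology" and A :: "'m chart set" and g :: "'m metric"
    and I :: "real set" and \<alpha> :: "real \<Rightarrow> 'm" and f :: "'m \<Rightarrow> real"
  assumes "lorentzian_4_manifold M A g"
    and "smooth_fun A f"
    and "null_curve M A g I \<alpha>"
    and "eikonal_along A g I \<alpha> f"
  shows "null_eikonal_helix M A g I \<alpha> f \<longleftrightarrow>
           linear_along I \<alpha> f \<and> \<not> (f \<circ> \<alpha>) constant_on I"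
proof -
  have curve: "smooth_curve M A I \<alpha>"
    using assms(3) unfolding null_curve_def by blast
  then have I: "open I" "is_interval I" "I \<noteq> {}"
    unfolding smooth_curve_def by auto
  have "((f \<circ> \<alpha>) has_real_derivative deriv (f \<circ> \<alpha>) t) (at t)" if "t \<in> I" for t
    using smooth_fun_along_curve_has_derivative[OF _ curve assms(2) that] assms(1)
    unfolding lorentzian_4_manifold_def by blast
  then have slope: "((f \<circ> \<alpha>) has_real_derivative c) (at t) \<longleftrightarrow>
      g (\<alpha> t) (gradient A g f (\<alpha> t)) (velocity A \<alpha> t) = c" if "t \<in> I" for t c
    using gradient_velocity_eq_deriv[OF assms(1) curve assms(2) that] that DERIV_imp_deriv by metis
  have "null_eikonal_helix M A g I \<alpha> f \<longleftrightarrow>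
      (\<exists>c. c \<noteq> 0 \<and> (\<forall>t\<in>I. ((f \<circ> \<alpha>) has_real_derivative c) (at t)))"
    using assms(3,4) slope unfolding null_eikonal_helix_def by simp
  also have "\<dots> \<longleftrightarrow> linear_along I \<alpha> f \<and> \<not> (f \<circ> \<alpha>) constant_on I"
    unfolding linear_along_def using constant_on_interval_iff_slope_zero[OF I, of "f \<circ> \<alpha>"] by blast
  finally show ?thesis .
qed

end
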